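(* Let $h=h(x,u)$ be a smooth function of $x$ in a neighborhood of $\mathbb{S}^2$ in $\mathbb{R}^3$ and of $u\in\mathbb{R}$. Let $\Phi(x,u)=\nabla h(x,u)$ (the Euclidean gradient in $\mathbb{R}^3$ with respect to $x$), restricted to $x\in\mathbb{S}^2$, and define the flux vector $F(x,u)=n(x)\times\Phi(x,u)$ for $x\in\mathbb{S}^2$, $u\in\mathbb{R}$. Then $F$ is geometry-compatible, that is, for every fixed $v\in\mathbb{R}$, $$\nabla_T\cdot F(x,v)=0\qquad\text{for all }x\in\mathbb{S}^2 .$$
   Context: $\mathbb{S}^2=\{x=(x_1,x_2,x_3)\in\mathbb{R}^3: x_1^2+x_2^2+x_3^2=1\}$ is the unit sphere, $n(x)$ is the outward unit normal to $\mathbb{S}^2$ at $x$ (so $n(x)=x$), and $\times$ is the cross product in $\mathbb{R}^3$. A flux vector is a family $F(\cdot,u)$ of tangent vector fields on $\mathbb{S}^2$ depending on a real parameter $u$. $\nabla_T\cdot$ denotes the tangential (Riemannian) divergence on $\mathbb{S}^2$ with its standard round metric; in longitude $\lambda$ and latitude $\phi$ (so $x=(\cos\phi\cos\lambda,\cos\phi\sin\lambda,\sin\phi)$), for a tangent field $F=F_\lambda i_\lambda+F_\phi i_\phi$ with $i_\lambda=(-\sin\lambda,\cos\lambda,0)$ and $i_\phi=(-\sin\phi\cos\lambda,-\sin\phi\sin\lambda,\cos\phi)$, one has $\nabla_T\cdot F=\frac{1}{\cos\phi}\left(\frac{\partial}{\partial\phi}(F_\phi\cos\phi)+\frac{\partial}{\partial\lambda}F_\lambda\right)$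 away from the poles. In "$\nabla_T\cdot F(x,v)$" the parameter $v$ is held fixed and only $x$ is differentiated. *)

theory Defs
  imports "HOL-Analysis.Analysis"
begin

text \<open>Smoothness on open sets: all iterated directional derivatives exist as functions that are
  again Frechet differentiable. For open \<open>S\<close>, \<open>smooth_on S f\<close> is the usual \<open>C\<^sup>\<infinity>\<close> property.\<close>

fun times_differentiable_on ::
  "'a::real_normed_vector set \<Rightarrow> ('a \<Rightarrow> 'b::real_normed_vector) \<Rightarrow> nat \<Rightarrow> bool"
where
  "times_differentiable_on S f 0 \<longleftrightarrow> continuous_on S f"
| "times_differentiable_on S f (Suc n) \<longleftrightarrow>
     (\<forall>x\<in>S. f differentiable (at x)) \<and>
     (\<forall>v. times_differentiable_on S (\<lambda>x. frechet_derivative f (at x) v) n)"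

definition smooth_on ::
  "'a::real_normed_vector set \<Rightarrow> ('a \<Rightarrow> 'b::real_normed_vector) \<Rightarrow> bool"
where
  "smooth_on S f \<longleftrightarrow> (\<forall>n. times_differentiable_on S f n)"


abbreviation S2 :: "(real^3) set"
  where "S2 \<equiv> sphere 0 1"

definition unit_normal :: "real^3 \<Rightarrow> real^3"
  where "unit_normal x = x"

definition tangent_space :: "real^3 \<Rightarrow> (real^3) set"
  where "tangent_space x = {v. v \<bullet> unit_normal x = 0}"

definition tangent_proj :: "real^3 \<Rightarrow> real^3 \<Rightarrow> real^3"
  where "tangent_proj x v = v - (v \<bullet> unit_normal x) *\<^sub>R unit_normal x"

definition tangent_field :: "(real^3 \<Rightarrow> real^3) \<Rightarrow> bool"
  where "tangent_field F \<longleftrightarrow> (\<forall>x\<in>S2. F x \<in> tangent_space x)"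

text \<open>The Levi-Civita connection of the round metric is the tangential part of the ambient
  derivative. A derivative \<open>D\<close> within \<open>S2\<close> is determined only on the tangent space, so only the
  values of \<open>D\<close> and \<open>A\<close> on tangent vectors are used.\<close>

definition has_covariant_derivative ::
  "(real^3 \<Rightarrow> real^3) \<Rightarrow> (real^3 \<Rightarrow> real^3) \<Rightarrow> real^3 \<Rightarrow> bool"
where
  "has_covariant_derivative F A x \<longleftrightarrow>
     (\<exists>D. (F has_derivative D) (at x within S2) \<and>
          (\<forall>v\<in>tangent_space x. A v = tangent_proj x (D v)))"

definition orthonormal_tangent_basis :: "real^3 \<Rightarrow> real^3 \<Rightarrow> real^3 \<Rightarrow> bool"
where
  "orthonormal_tangent_basis x e1 e2 \<longleftrightarrow>
     e1 \<in> tangent_space x \<and> e2 \<in> tangent_space x \<and> norm e1 = 1 \<and> norm e2 = 1 \<and> e1 \<bullet> e2 = 0"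

text \<open>The Riemannian divergence is the trace of the covariant derivative; the trace does not
  depend on the orthonormal basis.\<close>

definition has_tangential_divergence :: "(real^3 \<Rightarrow> real^3) \<Rightarrow> real \<Rightarrow> real^3 \<Rightarrow> bool"
where
  "has_tangential_divergence F d x \<longleftrightarrow>
     (\<exists>A. has_covariant_derivative F A x \<and>
          (\<forall>e1 e2. orthonormal_tangent_basis x e1 e2 \<longrightarrow> d = A e1 \<bullet> e1 + A e2 \<bullet> e2))"

definition flux_vector :: "(real^3 \<Rightarrow> real \<Rightarrow> real^3) \<Rightarrow> bool"
  where "flux_vector F \<longleftrightarrow> (\<forall>u. tangent_field (\<lambda>x. F x u))"

definition geometry_compatible :: "(real^3 \<Rightarrow> real \<Rightarrow> real^3) \<Rightarrow> bool"
where
  "geometry_compatible F \<longleftrightarrow>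
     flux_vector F \<and> (\<forall>v. \<forall>x\<in>S2. has_tangential_divergence (\<lambda>y. F y v) 0 x)"


lemma S2_unit: "x \<in> S2 \<Longrightarrow> x \<bullet> x = 1"
  by (simp add: norm_eq_1)

lemma orthonormal_tangent_basis_exists:
  assumes "x \<in> S2"
  shows "\<exists>e1 e2. orthonormal_tangent_basis x e1 e2"
proof -
  obtain y where y: "y \<noteq> 0" "orthogonal x y"
    using orthogonal_to_vector_exists[of x] by auto
  define e where "e = y /\<^sub>R norm y"
  have e: "e \<bullet> x = 0" "norm e = 1"
    using y by (auto simp: e_def orthogonal_def inner_commute)
  have "(norm (cross3 x e))\<^sup>2 = 1"
    using norm_cross[of x e] e assms by (simp add: inner_commute)
  then have "norm (cross3 x e) = 1"
    by (smt (verit) norm_ge_zero power2_eq_1_iff)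
  then have "orthonormal_tangent_basis x e (cross3 x e)"
    using e by (simp add: orthonormal_tangent_basis_def tangent_space_def unit_normal_def
        dot_cross_self)
  then show ?thesis by blast
qed

lemma orthonormal_tangent_basis_expand:
  assumes "x \<in> S2" "orthonormal_tangent_basis x e1 e2" "v \<in> tangent_space x"
  shows "v = (v \<bullet> e1) *\<^sub>R e1 + (v \<bullet> e2) *\<^sub>R e2"
proof -
  have o: "e1 \<bullet> e1 = 1" "e2 \<bullet> e2 = 1" "e1 \<bullet> e2 = 0" "e2 \<bullet> e1 = 0"
    "x \<bullet> e1 = 0" "x \<bullet> e2 = 0" "e1 \<bullet> x = 0" "e2 \<bullet> x = 0" "x \<bullet> x = 1" "v \<bullet> x = 0"
    using assms by (auto simp: orthonormal_tangent_basis_def tangent_space_def unit_normal_def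
        norm_eq_1 inner_commute)
  define B where "B = {x, e1, e2}"
  have ne: "x \<noteq> e1" "x \<noteq> e2" "e1 \<noteq> e2" "0 \<notin> B" using o by (auto simp: B_def)
  have "pairwise orthogonal B"
    using o by (auto simp: B_def pairwise_def orthogonal_def inner_commute)
  then have "independent B" using ne by (intro pairwise_orthogonal_independent)
  moreover have "card B = 3" using ne by (simp add: B_def)
  ultimately have "span B = UNIV"
    using card_ge_dim_independent[of B UNIV] by auto
  define w where "w = v - ((v \<bullet> e1) *\<^sub>R e1 + (v \<bullet> e2) *\<^sub>R e2)"
  have "\<And>b. b \<in> B \<Longrightarrow> orthogonal w b"
    using o by (auto simp: B_def w_def orthogonal_def inner_diff_left inner_add_left)
  then have "orthogonal w w"
    using orthogonal_to_span[of w B w] \<open>span B = UNIV\<close> by auto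
  then show ?thesis by (simp add: w_def orthogonal_def)
qed

lemma trace_basis_independent:
  assumes x: "x \<in> S2" and D: "linear D"
    and e: "orthonormal_tangent_basis x e1 e2" and f: "orthonormal_tangent_basis x f1 f2"
  shows "D e1 \<bullet> e1 + D e2 \<bullet> e2 = D f1 \<bullet> f1 + D f2 \<bullet> f2"
proof -
  have ft: "f1 \<in> tangent_space x" "f2 \<in> tangent_space x"
    and et: "e1 \<in> tangent_space x" "e2 \<in> tangent_space x"
    using e f by (auto simp: orthonormal_tangent_basis_def)
  define T where "T v = (v \<bullet> e1) *\<^sub>R e1 + (v \<bullet> e2) *\<^sub>R e2" for v
  have *: "D f \<bullet> f = (f \<bullet> e1) * (D e1 \<bullet> f) + (f \<bullet> e2) * (D e2 \<bullet> f)" 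
    if "f \<in> tangent_space x" for f
  proof -
    have "D f = D ((f \<bullet> e1) *\<^sub>R e1 + (f \<bullet> e2) *\<^sub>R e2)"
      using orthonormal_tangent_basis_expand[OF x e that] by simp
    then show ?thesis by (simp add: linear_add[OF D] linear_scale[OF D] inner_add_left)
  qed
  have **: "D e \<bullet> e = (e \<bullet> f1) * (D e \<bullet> f1) + (e \<bullet> f2) * (D e \<bullet> f2)" 
    if "e \<in> tangent_space x" for e
  proof -
    have "D e \<bullet> e = D e \<bullet> ((e \<bullet> f1) *\<^sub>R f1 + (e \<bullet> f2) *\<^sub>R f2)"
      using orthonormal_tangent_basis_expand[OF x f that] by simp
    then show ?thesis by (simp add: inner_add_right)
  qed
  show ?thesis
    unfolding *[OF ft(1)] *[OF ft(2)] **[OF et(1)] **[OF et(2)]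
    by (simp add: inner_commute)
qed

lemma tangent_proj_inner:
  "e \<in> tangent_space x \<Longrightarrow> tangent_proj x v \<bullet> e = v \<bullet> e"
  by (simp add: tangent_proj_def tangent_space_def inner_diff_left inner_commute[of "unit_normal x"])

lemma has_tangential_divergence_iff:
  assumes "x \<in> S2" "orthonormal_tangent_basis x e1 e2"
  shows "has_tangential_divergence F d x \<longleftrightarrow>
    (\<exists>D. (F has_derivative D) (at x within S2) \<and> d = D e1 \<bullet> e1 + D e2 \<bullet> e2)"
    (is "_ \<longleftrightarrow> ?R")
proof
  assume "has_tangential_divergence F d x"
  then obtain A D where D: "(F has_derivative D) (at x within S2)"
    and A: "\<And>v. v \<in> tangent_space x \<Longrightarrow> A v = tangent_proj x (D v)"
    and d: "d = A e1 \<bullet> e1 + A e2 \<bullet> e2"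
    using assms(2) unfolding has_tangential_divergence_def has_covariant_derivative_def by blast
  have "e1 \<in> tangent_space x" "e2 \<in> tangent_space x"
    using assms(2) by (auto simp: orthonormal_tangent_basis_def)
  then have "d = D e1 \<bullet> e1 + D e2 \<bullet> e2"
    using A d by (simp add: tangent_proj_inner)
  with D show ?R by blast
next
  assume ?R
  then obtain D where D: "(F has_derivative D) (at x within S2)"
    and d: "d = D e1 \<bullet> e1 + D e2 \<bullet> e2" by blast
  have "d = tangent_proj x (D f1) \<bullet> f1 + tangent_proj x (D f2) \<bullet> f2"
    if "orthonormal_tangent_basis x f1 f2" for f1 f2
    using trace_basis_independent[OF assms(1) has_derivative_linear[OF D] assms(2) that] d that
    by (simp add: orthonormal_tangent_basis_def tangent_proj_inner)
  then show "has_tangential_divergence F d x"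
    unfolding has_tangential_divergence_def has_covariant_derivative_def
    using D by (intro exI[of _ "\<lambda>v. tangent_proj x (D v)"]) blast
qed

lemma has_tangential_divergence_exists:
  assumes "x \<in> S2" "F differentiable (at x within S2)"
  shows "\<exists>d. has_tangential_divergence F d x"
  using orthonormal_tangent_basis_exists[OF assms(1)] assms(2)
    has_tangential_divergence_iff[OF assms(1)] unfolding differentiable_def by metis

lemma has_derivative_along_S2_curve:
  assumes F: "(F has_derivative D) (at (c t) within S2)"
    and c: "(c has_vector_derivative c') (at t)" and "\<And>s. c s \<in> S2"
  shows "((\<lambda>s. F (c s)) has_vector_derivative D c') (at t)"
proof -
  have "(F has_derivative D) (at (c t) within range c)"
    using F by (rule has_derivative_subset) (use assms(3) in auto)
  then have "((F \<circ> c) has_vector_derivative D c') (at t)"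
    by (rule vector_derivative_diff_chain_within[OF c])
  then show ?thesis by (simp add: o_def)
qed

lemma has_tangential_divergence_unique:
  assumes x: "x \<in> S2"
    and d: "has_tangential_divergence F d x" and d': "has_tangential_divergence F d' x"
  shows "d = d'"
proof -
  obtain e1 e2 where e: "orthonormal_tangent_basis x e1 e2"
    using orthonormal_tangent_basis_exists[OF x] by blast
  obtain D D' where D: "(F has_derivative D) (at x within S2)" "d = D e1 \<bullet> e1 + D e2 \<bullet> e2"
    and D': "(F has_derivative D') (at x within S2)" "d' = D' e1 \<bullet> e1 + D' e2 \<bullet> e2"
    using d d' unfolding has_tangential_divergence_iff[OF x e] by blast
  have "D v = D' v" if v: "v \<in> tangent_space x" "norm v = 1" for v
  proof -
    define c where "c t = cos t *\<^sub>R x + sin t *\<^sub>R v" for t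
    have c: "(c has_vector_derivative v) (at 0)"
      unfolding c_def by (auto intro!: derivative_eq_intros)
    have "c s \<in> S2" for s
    proof -
      have "c s \<bullet> c s = (cos s)\<^sup>2 + (sin s)\<^sup>2"
        using v x by (simp add: c_def inner_add_left inner_add_right tangent_space_def
            unit_normal_def norm_eq_1 inner_commute power2_eq_square)
      then show ?thesis by (simp add: norm_eq_1)
    qed
    moreover have "c 0 = x" by (simp add: c_def)
    ultimately show ?thesis
      using has_derivative_along_S2_curve[of F D c 0 v] has_derivative_along_S2_curve[of F D' c 0 v]
        D D' c vector_derivative_unique_at by metis
  qed
  then show ?thesis using e D D' by (simp add: orthonormal_tangent_basis_def)
qed

text \<open>Here \<open>l\<close> is the longitude and \<open>p\<close> the latitude.\<close>

definition sph :: "real \<Rightarrow> real \<Rightarrow> real^3"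
  where "sph l p = vector [cos p * cos l, cos p * sin l, sin p]"

definition i_lon :: "real \<Rightarrow> real \<Rightarrow> real^3"
  where "i_lon l p = vector [- sin l, cos l, 0]"

definition i_lat :: "real \<Rightarrow> real \<Rightarrow> real^3"
  where "i_lat l p = vector [- sin p * cos l, - sin p * sin l, cos p]"

lemma has_vector_derivative_vector3:
  assumes "(a has_real_derivative a') (at t)" "(b has_real_derivative b') (at t)"
    "(c has_real_derivative c') (at t)"
  shows "((\<lambda>s. vector [a s, b s, c s] :: real^3) has_vector_derivative vector [a', b', c']) (at t)"
proof -
  have eq: "vector [u, v, w] = u *\<^sub>R axis 1 1 + v *\<^sub>R axis 2 1 + w *\<^sub>R (axis 3 1 :: real^3)"
    for u v w :: real
    by (simp add: vec_eq_iff forall_3 axis_def)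
  show ?thesis unfolding eq
    using assms by (auto intro!: derivative_eq_intros simp: has_real_derivative_iff_has_vector_derivative)
qed

lemma has_tangential_divergence_coordinates:
  assumes F: "tangent_field F" and p: "cos p \<noteq> 0"
    and d: "has_tangential_divergence F d (sph l p)"
  obtains a b where
    "((\<lambda>q. (F (sph l q) \<bullet> i_lat l q) * cos q) has_real_derivative a) (at p)"
    "((\<lambda>m. F (sph m p) \<bullet> i_lon m p) has_real_derivative b) (at l)"
    "d = 1 / cos p * (a + b)"
proof -
  note defs = sph_def i_lon_def i_lat_def inner_vec_def sum_3 vector_3 inner_real_def
  have S: "sph l p \<in> S2" for l p
  proof -
    have "sph l p \<bullet> sph l p = (cos p)\<^sup>2 * ((cos l)\<^sup>2 + (sin l)\<^sup>2) + (sin p)\<^sup>2"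
      unfolding sph_def inner_vec_def sum_3 vector_3 inner_real_def by algebra
    then show ?thesis by (simp add: norm_eq_1)
  qed
  let ?x = "sph l p" and ?e = "i_lon l p" and ?f = "i_lat l p"
  have "?e \<bullet> ?e = (cos l)\<^sup>2 + (sin l)\<^sup>2"
    unfolding defs by algebra
  moreover have "?f \<bullet> ?f = (sin p)\<^sup>2 * ((cos l)\<^sup>2 + (sin l)\<^sup>2) + (cos p)\<^sup>2"
    unfolding defs by algebra
  moreover have "?f \<bullet> ?x = sin p * cos p * (1 - ((cos l)\<^sup>2 + (sin l)\<^sup>2))"
    unfolding defs by algebra
  moreover have "?e \<bullet> ?x = 0" "?e \<bullet> ?f = 0"
    unfolding defs by algebra+
  ultimately have e: "orthonormal_tangent_basis ?x ?e ?f"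
    by (simp add: orthonormal_tangent_basis_def tangent_space_def unit_normal_def norm_eq_1)
  obtain D where D: "(F has_derivative D) (at ?x within S2)"
    and d: "d = D ?e \<bullet> ?e + D ?f \<bullet> ?f"
    using d unfolding has_tangential_divergence_iff[OF S e] by blast
  have lin: "linear D" using D by (rule has_derivative_linear)
  have x0: "F ?x \<bullet> ?x = 0"
    using F S by (auto simp: tangent_field_def tangent_space_def unit_normal_def)
  have c1: "((\<lambda>q. sph l q) has_vector_derivative ?f) (at p)"
    unfolding sph_def i_lat_def
    by (rule has_vector_derivative_vector3) (auto intro!: derivative_eq_intros)
  have "((\<lambda>m. sph m p) has_vector_derivative 
      vector [- cos p * sin l, cos p * cos l, 0]) (at l)"
    unfolding sph_def
    by (rule has_vector_derivative_vector3) (auto intro!: derivative_eq_intros)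
  moreover have "vector [- cos p * sin l, cos p * cos l, 0] = cos p *\<^sub>R ?e"
    by (simp add: i_lon_def vec_eq_iff forall_3)
  ultimately have c2: "((\<lambda>m. sph m p) has_vector_derivative cos p *\<^sub>R ?e) (at l)"
    by simp
  have "((\<lambda>q. i_lat l q) has_vector_derivative 
      vector [- cos p * cos l, - cos p * sin l, - sin p]) (at p)"
    unfolding i_lat_def
    by (rule has_vector_derivative_vector3) (auto intro!: derivative_eq_intros)
  moreover have "vector [- cos p * cos l, - cos p * sin l, - sin p] = - ?x"
    by (simp add: sph_def vec_eq_iff forall_3)
  ultimately have c3: "((\<lambda>q. i_lat l q) has_vector_derivative - ?x) (at p)" by simp
  have "((\<lambda>m. i_lon m p) has_vector_derivative vector [- cos l, - sin l, 0]) (at l)"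
    unfolding i_lon_def
    by (rule has_vector_derivative_vector3) (auto intro!: derivative_eq_intros)
  moreover have "vector [- cos l, - sin l, 0] = sin p *\<^sub>R ?f - cos p *\<^sub>R ?x"
  proof -
    have "- cos l = sin p * (- sin p * cos l) - cos p * (cos p * cos l)"
      "- sin l = sin p * (- sin p * sin l) - cos p * (cos p * sin l)"
      using sin_cos_squared_add[of p] by algebra+
    then show ?thesis
      by (simp add: sph_def i_lat_def vec_eq_iff forall_3)
  qed
  ultimately have c4: "((\<lambda>m. i_lon m p) has_vector_derivative sin p *\<^sub>R ?f - cos p *\<^sub>R ?x) (at l)"
    by simp
  have F1: "((\<lambda>q. F (sph l q)) has_vector_derivative D ?f) (at p)"
    by (rule has_derivative_along_S2_curve[of F D "\<lambda>q. sph l q"]) (use D c1 S in auto)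
  have F2: "((\<lambda>m. F (sph m p)) has_vector_derivative cos p *\<^sub>R D ?e) (at l)"
    using has_derivative_along_S2_curve[of F D "\<lambda>m. sph m p" l, OF D c2 S]
    by (simp add: linear_scale[OF lin])
  have I: "((\<lambda>s. f s \<bullet> g s) has_real_derivative f t \<bullet> g' + f' \<bullet> g t) (at t)"
    if "(f has_vector_derivative f') (at t)" "(g has_vector_derivative g') (at t)"
    for f g :: "real \<Rightarrow> real^3" and f' g' t
    using has_derivative_inner[OF that[unfolded has_vector_derivative_def]]
    by (simp add: has_field_derivative_def distrib_left[symmetric] mult_commute_abs)
  have A: "((\<lambda>q. (F (sph l q) \<bullet> i_lat l q) * cos q) has_real_derivative
      (D ?f \<bullet> ?f) * cos p - (F ?x \<bullet> ?f) * sin p) (at p)"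
    using I[OF F1 c3] x0 by (auto intro!: derivative_eq_intros)
  have B: "((\<lambda>m. F (sph m p) \<bullet> i_lon m p) has_real_derivative
      (F ?x \<bullet> ?f) * sin p + cos p * (D ?e \<bullet> ?e)) (at l)"
    using I[OF F2 c4] x0 by (simp add: inner_diff_right mult.commute)
  show thesis
    by (rule that[OF A B]) (use p d in \<open>simp add: field_simps\<close>)
qed

end

theory Submission
  imports Defs
begin

text \<open>
  The derivative of \<open>y \<times> G y\<close> at \<open>x\<close> is \<open>e \<mapsto> e \<times> G x + x \<times> H e\<close>, where \<open>H\<close> is the Hessian of \<open>h\<close>.
  The first summand is orthogonal to \<open>e\<close>, so it does not contribute to the trace. Rotation by a
  right angle about \<open>x\<close> swaps the vectors of an orthonormal tangent basis up to sign, so the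
  second summand contributes \<open>\<plusminus> (H e1 \<bullet> e2 - H e2 \<bullet> e1)\<close>, which vanishes because \<open>H\<close> is
  symmetric.
\<close>

text \<open>The mean value theorem in the direction \<open>u\<close> turns the second difference
  into \<open>t\<close> times a difference of two values of \<open>f' y u\<close>. Differentiability
  of \<open>f' y u\<close> at \<open>x\<close> makes that difference \<open>t * D v\<close> up to an
  error that is small relative to \<open>t\<close>.\<close>

lemma second_difference_quotient_tendsto:
  fixes f :: "'a::real_normed_vector \<Rightarrow> real"
  assumes S: "open S" "x \<in> S"
    and f: "\<And>y. y \<in> S \<Longrightarrow> (f has_derivative f' y) (at y)"
    and D: "((\<lambda>y. f' y u) has_derivative D) (at x)"
  shows "((\<lambda>t. (f (x + t *\<^sub>R u + t *\<^sub>R v) - f (x + t *\<^sub>R u) - f (x + t *\<^sub>R v) + f x) / t\<^sup>2)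
    \<longlongrightarrow> D v) (at_right 0)"
proof (rule tendstoI)
  fix e :: real assume "e > 0"
  interpret D: bounded_linear D using D by (rule has_derivative_bounded_linear)
  \<comment> \<open>The displacements \<open>s *\<^sub>R u + r *\<^sub>R v\<close> with
    \<open>s\<close>, \<open>r\<close> in \<open>[0, t]\<close> have norm at most
    \<open>t * m\<close>. The summand 1 keeps \<open>m\<close> positive when \<open>u\<close> and
    \<open>v\<close> vanish, so that division by \<open>m\<close> is safe.\<close>
  define m where "m = norm u + norm v + 1"
  have m: "m > 0" by (simp add: m_def add_nonneg_pos)
  \<comment> \<open>Two errors of size \<open>e' * (t * m)\<close> will add up to
    \<open>e * t / 2\<close>, which is strictly below \<open>e * t\<close>.\<close>
  define e' where "e' = e / (4 * m)"
  have "e' > 0" using \<open>e > 0\<close> m by (simp add: e'_def)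
  then obtain d1 where d1: "d1 > 0" "\<And>y. norm (y - x) < d1 \<Longrightarrow>
      \<bar>f' y u - f' x u - D (y - x)\<bar> \<le> e' * norm (y - x)"
    using D unfolding has_derivative_at_alt real_norm_def by blast
  obtain d2 where d2: "d2 > 0" "ball x d2 \<subseteq> S"
    using S openE by blast
  define d where "d = min d1 d2 / m"
  have "d > 0" using d1 d2 m by (simp add: d_def)
  show "\<forall>\<^sub>F t in at_right 0. dist ((f (x + t *\<^sub>R u + t *\<^sub>R v) - f (x + t *\<^sub>R u) -
      f (x + t *\<^sub>R v) + f x) / t\<^sup>2) (D v) < e"
  proof (rule eventually_at_rightI[OF _ \<open>d > 0\<close>])
    fix t assume t: "t \<in> {0<..<d}"
    then have t0: "t > 0" and "t * m < min d1 d2"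
      using m by (auto simp: d_def field_simps)
    have small: "norm (s *\<^sub>R u + r *\<^sub>R v) \<le> t * m" if "0 \<le> s" "s \<le> t" "0 \<le> r" "r \<le> t" for s r
    proof -
      have "norm (s *\<^sub>R u + r *\<^sub>R v) \<le> s * norm u + r * norm v"
        using that norm_triangle_ineq[of "s *\<^sub>R u" "r *\<^sub>R v"] by simp
      also have "\<dots> \<le> t * norm u + t * norm v"
        using that by (intro add_mono mult_right_mono) auto
      also have "\<dots> \<le> t * m" using t0 by (simp add: m_def algebra_simps)
      finally show ?thesis .
    qed
    have inS: "x + s *\<^sub>R u + r *\<^sub>R v \<in> S" if "0 \<le> s" "s \<le> t" "0 \<le> r" "r \<le> t" for s r
    proof -
      have "dist (x + s *\<^sub>R u + r *\<^sub>R v) x < d2"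
        using small[OF that] \<open>t * m < _\<close> by (simp add: dist_norm add.assoc)
      then have "x + s *\<^sub>R u + r *\<^sub>R v \<in> ball x d2"
        by (simp add: dist_commute)
      then show ?thesis using d2 by blast
    qed
    have near: "\<bar>f' (x + s *\<^sub>R u + r *\<^sub>R v) u - f' x u - D (s *\<^sub>R u + r *\<^sub>R v)\<bar> \<le> e' * (t * m)"
      if "0 \<le> s" "s \<le> t" "0 \<le> r" "r \<le> t" for s r
    proof -
      have eq: "x + s *\<^sub>R u + r *\<^sub>R v - x = s *\<^sub>R u + r *\<^sub>R v" by simp
      have "\<bar>f' (x + s *\<^sub>R u + r *\<^sub>R v) u - f' x u - D (s *\<^sub>R u + r *\<^sub>R v)\<bar> \<le>
          e' * norm (s *\<^sub>R u + r *\<^sub>R v)"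
        using d1(2)[of "x + s *\<^sub>R u + r *\<^sub>R v"] small[OF that] \<open>t * m < _\<close> unfolding eq by simp
      also have "\<dots> \<le> e' * (t * m)"
        using small[OF that] \<open>e' > 0\<close> by simp
      finally show ?thesis .
    qed
    have der: "((\<lambda>s. f (x + s *\<^sub>R u + r *\<^sub>R v)) has_real_derivative
        f' (x + s *\<^sub>R u + r *\<^sub>R v) u) (at s)"
      if "0 \<le> s" "s \<le> t" "0 \<le> r" "r \<le> t" for s r
    proof -
      have "((\<lambda>s. x + s *\<^sub>R u + r *\<^sub>R v) has_derivative (\<lambda>k. k *\<^sub>R u)) (at s)"
        by (auto intro!: derivative_eq_intros)
      from has_derivative_compose[OF this f[OF inS[OF that]]]
      show ?thesis
        using linear_scale[OF has_derivative_linear[OF f[OF inS[OF that]]]]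
        by (simp add: has_field_derivative_def mult_commute_abs)
    qed
    \<comment> \<open>The summand \<open>0 *\<^sub>R v\<close> makes both terms instances of
      \<open>der\<close>, with \<open>r = t\<close> and \<open>r = 0\<close>.\<close>
    define \<phi> where "\<phi> s = f (x + s *\<^sub>R u + t *\<^sub>R v) - f (x + s *\<^sub>R u + 0 *\<^sub>R v)" for s
    have "\<exists>z. 0 < z \<and> z < t \<and> \<phi> t - \<phi> 0 =
        (t - 0) * (f' (x + z *\<^sub>R u + t *\<^sub>R v) u - f' (x + z *\<^sub>R u + 0 *\<^sub>R v) u)"
      unfolding \<phi>_def using t0 by (intro MVT2 DERIV_diff der) auto
    then obtain z where z: "0 < z" "z < t" and \<phi>: "\<phi> t - \<phi> 0 =
        t * (f' (x + z *\<^sub>R u + t *\<^sub>R v) u - f' (x + z *\<^sub>R u + 0 *\<^sub>R v) u)"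
      by auto
    \<comment> \<open>The two linear approximations differ by \<open>D (z *\<^sub>R u + t *\<^sub>R
      v) - D (z *\<^sub>R u) = t * D v\<close>, so the unknown intermediate point \<open>z\<close>
      drops out.\<close>
    have "\<bar>f' (x + z *\<^sub>R u + t *\<^sub>R v) u - f' (x + z *\<^sub>R u + 0 *\<^sub>R v) u - t * D v\<bar> \<le> 2 * (e' * (t * m))"
      using near[of z t] near[of z 0] z t0 by (simp add: D.add D.scaleR)
    also have "\<dots> < e * t"
      using \<open>e > 0\<close> m t0 by (simp add: e'_def field_simps)
    finally have "\<bar>(f' (x + z *\<^sub>R u + t *\<^sub>R v) u - f' (x + z *\<^sub>R u + 0 *\<^sub>R v) u - t * D v) / t\<bar> < e"
      using t0 by (simp add: field_simps)
    moreover have "(f' (x + z *\<^sub>R u + t *\<^sub>R v) u - f' (x + z *\<^sub>R u + 0 *\<^sub>R v) u - t * D v) / t =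
        (\<phi> t - \<phi> 0) / t\<^sup>2 - D v"
      unfolding \<phi> using t0 by (simp add: field_simps power2_eq_square)
    moreover have "\<phi> t - \<phi> 0 =
        f (x + t *\<^sub>R u + t *\<^sub>R v) - f (x + t *\<^sub>R u) - f (x + t *\<^sub>R v) + f x"
      by (simp add: \<phi>_def)
    ultimately show "dist ((f (x + t *\<^sub>R u + t *\<^sub>R v) - f (x + t *\<^sub>R u) - f (x + t *\<^sub>R v) + f x) / t\<^sup>2)
        (D v) < e"
      by (simp only: dist_real_def)
  qed
qed

text \<open>The second difference quotient is unchanged when \<open>u\<close> and \<open>v\<close>
  are swapped, so both mixed derivatives are limits of the same function.\<close>

lemma second_derivative_symmetric:
  fixes f :: "'a::real_normed_vector \<Rightarrow> real"
  assumes "open S" "x \<in> S"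
    and "\<And>y. y \<in> S \<Longrightarrow> (f has_derivative f' y) (at y)"
    and "((\<lambda>y. f' y u) has_derivative Du) (at x)"
    and "((\<lambda>y. f' y v) has_derivative Dv) (at x)"
  shows "Du v = Dv u"
proof -
  let ?q = "\<lambda>u v t. (f (x + t *\<^sub>R u + t *\<^sub>R v) - f (x + t *\<^sub>R u) - f (x + t *\<^sub>R v) + f x) / t\<^sup>2"
  have "(?q u v \<longlongrightarrow> Du v) (at_right 0)"
    using assms(1-3) by (rule second_difference_quotient_tendsto) (assumption | rule assms(4))+
  moreover have "(?q v u \<longlongrightarrow> Dv u) (at_right 0)"
    using assms(1-3) by (rule second_difference_quotient_tendsto) (assumption | rule assms(5))+
  moreover have "?q v u = ?q u v"
    by (simp add: algebra_simps)
  ultimately show ?thesis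
    by (simp only: tendsto_unique[OF trivial_limit_at_right_real])
qed

lemma gradient_derivative_symmetric:
  assumes "open S" "x \<in> S"
    and f: "\<And>y. y \<in> S \<Longrightarrow> GDERIV f y :> G y"
    and G: "(G has_derivative H) (at x)"
  shows "H u \<bullet> v = H v \<bullet> u"
proof -
  have D: "((\<lambda>y. w \<bullet> G y) has_derivative (\<lambda>k. w \<bullet> H k)) (at x)" for w
    using G by (rule has_derivative_inner_right)
  have "v \<bullet> H u = u \<bullet> H v"
    using second_derivative_symmetric[where f = f and f' = "\<lambda>y k. k \<bullet> G y", OF assms(1,2) f[unfolded gderiv_def] D D] .
  then show ?thesis by (simp add: inner_commute)
qed

text \<open>Freezing the parameter restricts the joint derivatives to the slice
  \<open>y \<mapsto> (y, v)\<close>, where only directions \<open>(w, 0)\<close> occur. The result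
  is a gradient on all of \<open>U\<close>, which can be differentiated in the ambient
  space.\<close>

lemma smooth_on_imp_differentiable_gradient:
  fixes h :: "'a::euclidean_space \<Rightarrow> 'b::real_normed_vector \<Rightarrow> real"
  assumes "smooth_on (U \<times> UNIV) (\<lambda>(x, u). h x u)"
  obtains G where "\<And>y. y \<in> U \<Longrightarrow> GDERIV (\<lambda>y. h y v) y :> G y"
    and "\<And>y. y \<in> U \<Longrightarrow> G differentiable (at y)"
proof -
  define k where "k = (\<lambda>(x, u). h x u)"
  have "times_differentiable_on (U \<times> UNIV) k (Suc (Suc 0))"
    using assms unfolding smooth_on_def k_def by blast
  then have k: "\<And>y. y \<in> U \<Longrightarrow> k differentiable (at (y, v))"
    and k2: "\<And>y w. y \<in> U \<Longrightarrow> (\<lambda>z. frechet_derivative k (at z) w) differentiable (at (y, v))"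
    by auto
  define g where "g y w = frechet_derivative k (at (y, v)) (w, 0)" for y w
  \<comment> \<open>The Riesz vector of the linear form \<open>g y\<close>: its components are the
    partial derivatives along \<open>Basis\<close>.\<close>
  define G where "G y = (\<Sum>b\<in>Basis. g y b *\<^sub>R b)" for y
  have embed: "((\<lambda>y. (y, v)) has_derivative (\<lambda>w. (w, 0))) (at y)" for y :: 'a
    by (auto intro!: derivative_eq_intros)
  show thesis
  proof
    fix y assume y: "y \<in> U"
    have g: "((\<lambda>y. h y v) has_derivative g y) (at y)"
      using has_derivative_compose[OF embed k[OF y, unfolded frechet_derivative_works]]
      by (simp add: k_def g_def[abs_def])
    have "g y = (\<lambda>w. w \<bullet> G y)"
    proof
      fix w
      have "g y w = g y (\<Sum>b\<in>Basis. (w \<bullet> b) *\<^sub>R b)"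
        by (simp add: euclidean_representation)
      then show "g y w = w \<bullet> G y"
        by (simp add: G_def inner_sum_right linear_sum[OF has_derivative_linear[OF g]]
            linear_scale[OF has_derivative_linear[OF g]] mult.commute)
    qed
    with g show "GDERIV (\<lambda>y. h y v) y :> G y"
      by (simp add: gderiv_def)
    have "(\<lambda>y. g y w) differentiable (at y)" for w
      unfolding g_def differentiable_def
      using has_derivative_compose[OF embed k2[OF y, unfolded frechet_derivative_works]] by blast
    then show "G differentiable (at y)"
      unfolding G_def by (intro differentiable_sum differentiable_scaleR) auto
  qed
qed

text \<open>The triple product moves the rotation from \<open>H e1\<close> and \<open>H e2\<close>
  to the basis vectors, and the trace becomes
  \<open>c * (H e1 \<bullet> e2 - H e2 \<bullet> e1)\<close>.\<close>

lemma trace_cross3_symmetric: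
  assumes x: "x \<in> S2" and e: "orthonormal_tangent_basis x e1 e2"
    and H: "H e1 \<bullet> e2 = H e2 \<bullet> e1"
  shows "cross3 x (H e1) \<bullet> e1 + cross3 x (H e2) \<bullet> e2 = 0"
proof -
  \<comment> \<open>This is 1 or -1 according to the orientation of the basis; keeping it symbolic
    treats both cases at once.\<close>
  define c where "c = cross3 e1 x \<bullet> e2"
  have rot: "cross3 x a \<bullet> b = a \<bullet> cross3 b x" for a b
    by (simp add: cross3_simps)
  have tan: "cross3 b x \<in> tangent_space x" for b
    by (simp add: tangent_space_def unit_normal_def dot_cross_self)
  have "cross3 e2 x \<bullet> e1 = - c"
    by (simp add: c_def cross3_simps)
  moreover have "cross3 b x \<bullet> b = 0" for b
    by (simp add: dot_cross_self)
  ultimately have "cross3 e1 x = c *\<^sub>R e2" "cross3 e2 x = (- c) *\<^sub>R e1"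
    using orthonormal_tangent_basis_expand[OF x e tan, of e1]
      orthonormal_tangent_basis_expand[OF x e tan, of e2] by (simp_all add: c_def)
  then show ?thesis by (simp add: rot H)
qed

theorem claim2p2:
  fixes h :: "real^3 \<Rightarrow> real \<Rightarrow> real"
    and \<Phi> F :: "real^3 \<Rightarrow> real \<Rightarrow> real^3"
    and U :: "(real^3) set"
  assumes "open U" and "S2 \<subseteq> U"
    and "smooth_on (U \<times> UNIV) (\<lambda>(x, u). h x u)"
    and "\<And>x u. x \<in> S2 \<Longrightarrow> GDERIV (\<lambda>y. h y u) x :> \<Phi> x u"
    and "\<And>x u. x \<in> S2 \<Longrightarrow> F x u = cross3 (unit_normal x) (\<Phi> x u)"
  shows "geometry_compatible F"
  unfolding geometry_compatible_def
proof (intro conjI allI ballI)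
  show "flux_vector F"
    by (simp add: flux_vector_def tangent_field_def tangent_space_def assms(5) dot_cross_self
        del: mem_sphere_0)
next
  fix v x assume x: "x \<in> S2"
  \<comment> \<open>\<open>\<Phi>\<close> is prescribed on the sphere only, while the symmetry of
    the Hessian requires a gradient on an open set; \<open>G\<close> supplies it.\<close>
  obtain G where G: "\<And>y. y \<in> U \<Longrightarrow> GDERIV (\<lambda>y. h y v) y :> G y"
      "\<And>y. y \<in> U \<Longrightarrow> G differentiable (at y)"
    using smooth_on_imp_differentiable_gradient[OF assms(3)] by blast
  have xU: "x \<in> U" using x assms(2) by blast
  obtain H where H: "(G has_derivative H) (at x)"
    using G(2)[OF xU] by (auto simp: differentiable_def)
  have "\<Phi> y v = G y" if "y \<in> S2" for y
  proof -
    have "(\<lambda>w. w \<bullet> \<Phi> y v) = (\<lambda>w. w \<bullet> G y)"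
      using assms(2,4) G(1) that unfolding gderiv_def by (blast intro: has_derivative_unique)
    then show ?thesis by (metis vector_eq_rdot inner_commute)
  qed
  then have F: "F y v = cross3 y (G y)" if "y \<in> S2" for y
    using that assms(5) by (simp add: unit_normal_def del: mem_sphere_0)
  interpret bounded_bilinear cross3
    using bilinear_cross by (simp add: bilinear_conv_bounded_bilinear)
  have "((\<lambda>y. cross3 y (G y)) has_derivative (\<lambda>w. cross3 x (H w) + cross3 w (G x))) (at x within S2)"
    by (intro FDERIV has_derivative_ident has_derivative_at_withinI[OF H])
  \<comment> \<open>\<open>F\<close> is known on the sphere only, and agreement there suffices for a
    derivative within \<open>S2\<close>.\<close>
  then have D: "((\<lambda>y. F y v) has_derivative (\<lambda>w. cross3 x (H w) + cross3 w (G x))) (at x within S2)"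
    by (rule has_derivative_transform[OF x F, rotated])
  \<comment> \<open>By \<open>has_tangential_divergence_iff\<close>, the trace in a single
    orthonormal basis determines the divergence.\<close>
  obtain e1 e2 where e: "orthonormal_tangent_basis x e1 e2"
    using orthonormal_tangent_basis_exists[OF x] by blast
  have "H e1 \<bullet> e2 = H e2 \<bullet> e1"
    using gradient_derivative_symmetric[OF assms(1) xU G(1) H] .
  from trace_cross3_symmetric[where H = H, OF x e this]
  have "0 = (cross3 x (H e1) + cross3 e1 (G x)) \<bullet> e1 + (cross3 x (H e2) + cross3 e2 (G x)) \<bullet> e2"
    by (simp add: inner_add_left dot_cross_self)
  with D show "has_tangential_divergence (\<lambda>y. F y v) 0 x"
    unfolding has_tangential_divergence_iff[OF x e] by blast
qed

end
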